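(* Consider the SGUM game for database assisted spectrum access, with players $\mathcal N=\{1,\dots,N\}$, finite strategy sets $\mathcal M_n$ and payoffs $S_n$. Suppose that all users have the same transmission power ($P_n=P_m$ for all $n,m\in\mathcal N$), that the physical interference graph is undirected, and that the social tie between any two users is symmetric ($w_{nm}=w_{mn}$). Then the game is a potential game with potential function $$\Phi(\boldsymbol a)=-\frac12\sum_{n=1}^N\sum_{m\in\mathcal N_n^p}P_m d_{mn}^{-\alpha}I_{\{a_n=a_m\}}-\sum_{n=1}^N\omega^n_{a_n}-\frac12\sum_{n=1}^N\sum_{m\in\mathcal N_n^{sp}}w_{nm}P_m d_{mn}^{-\alpha}I_{\{a_n=a_m\}},$$ that is, for every $n\in\mathcal N$, every $a_{-n}\in\prod_{i\ne n}\mathcal M_i$ and all $a_n,a_n'\in\mathcal M_n$, $$S_n(a_n',a_{-n})-S_n(a_n,a_{-n})=\Phi(a_n',a_{-n})-\Phi(a_n,a_{-n}),$$ and hence the game has a socially-aware Nash equilibrium.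
   Context: Users: $\mathcal N=\{1,\dots,N\}$. User $n$ chooses a channel $a_n$ from a nonempty finite set $\mathcal M_n\subseteq\mathcal M=\{1,\dots,M\}$ of vacant channels; $\boldsymbol a=(a_1,\dots,a_N)\in\Omega=\prod_{n}\mathcal M_n$, and $a_{-n}$ denotes the choices of all users other than $n$. $P_m>0$ is the transmission power of user $m$, $d_{mn}=d_{nm}>0$ is the distance between users $m\neq n$, $\alpha>0$ is the path loss factor, $\omega^n_{a}$ is the (real) noise power of user $n$ on channel $a$, and $I_{\{A\}}$ is the indicator of $A$. Physical graph: a graph on $\mathcal N$ without loops; $e^p_{nm}=1$ iff $n,m$ can interfere with each other, and $\mathcal N_n^p=\{m:e^p_{nm}=1\}$. Social graph: a graph on $\mathcal N$ without loops; $e^s_{nm}=1$ iff $n,m$ have a social tie, and $\mathcal N_n^s=\{m:e^s_{nm}=1\}$ (this relation is symmetric). Each tie has a strength $w_{nm}\in[0,1]$. Physical-social neighbours: $\mathcal N_n^{sp}=\{m:e^s_{nm}e^p_{nm}=1\}=\mathcal N_n^s\cap\mathcal N_n^p$. Individual utility: $U_n(\boldsymbol a)=-\sum_{m\in\mathcal N_n^p}P_m d_{mn}^{-\alpha}I_{\{a_n=a_m\}}-\omega^n_{a_n}$. Social group utility: $S_n(\boldsymbol a)=U_n(\boldsymbol a)+\sum_{m\in\mathcal N_n^s}w_{nm}U_m(\boldsymbol a)$. The SGUM game has players $\mathcal N$, strategy sets $\mathcal M_n$ and payoffs $S_n$. A socially-aware Nash equilibrium (SNE) is a profile $\boldsymbol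 a^*$ such that, for every $n$, $a_n^*$ maximizes $S_n(\cdot,a^*_{-n})$ over $\mathcal M_n$. *)

theory Defs
  imports Complex_Main "HOL-Library.FuncSet"
begin

text \<open>Strategic games with player set \<open>I\<close>, strategy sets \<open>A i\<close> and payoffs \<open>u i\<close>. A choice
  \<open>b\<close> of the players other than \<open>n\<close> is an element of \<open>Pi\<^sub>E (I - {n}) A\<close>, and \<open>b(n := x)\<close> is the
  profile in which \<open>n\<close> plays \<open>x\<close> against \<open>b\<close>.\<close>

definition exact_potential ::
  "'i set \<Rightarrow> ('i \<Rightarrow> 's set) \<Rightarrow> ('i \<Rightarrow> ('i \<Rightarrow> 's) \<Rightarrow> real) \<Rightarrow> (('i \<Rightarrow> 's) \<Rightarrow> real) \<Rightarrow> bool"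
where
  "exact_potential I A u \<Phi> \<longleftrightarrow>
     (\<forall>n\<in>I. \<forall>b\<in>Pi\<^sub>E (I - {n}) A. \<forall>x\<in>A n. \<forall>x'\<in>A n.
        u n (b(n := x')) - u n (b(n := x)) = \<Phi> (b(n := x')) - \<Phi> (b(n := x)))"

definition nash_equilibrium ::
  "'i set \<Rightarrow> ('i \<Rightarrow> 's set) \<Rightarrow> ('i \<Rightarrow> ('i \<Rightarrow> 's) \<Rightarrow> real) \<Rightarrow> ('i \<Rightarrow> 's) \<Rightarrow> bool"
where
  "nash_equilibrium I A u a \<longleftrightarrow>
     a \<in> Pi\<^sub>E I A \<and> (\<forall>n\<in>I. \<forall>x\<in>A n. u n (a(n := x)) \<le> u n a)"

text \<open>Users and channels are positive natural numbers. The fields are only meaningful for users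
  \<open>1, \<dots>, num_users\<close>, distances only between distinct users, and tie strengths only for pairs
  joined by a social tie.\<close>

record spectrum_network =
  num_users :: nat
  num_channels :: nat
  vacant :: "nat \<Rightarrow> nat set"
  tx_power :: "nat \<Rightarrow> real"
  distance :: "nat \<Rightarrow> nat \<Rightarrow> real"
  path_loss :: real
  noise :: "nat \<Rightarrow> nat \<Rightarrow> real"  \<comment> \<open>user, then channel\<close>
  phys_edge :: "nat \<Rightarrow> nat \<Rightarrow> bool"
  soc_edge :: "nat \<Rightarrow> nat \<Rightarrow> bool"
  tie_strength :: "nat \<Rightarrow> nat \<Rightarrow> real"

definition users :: "spectrum_network \<Rightarrow> nat set" where
  "users G = {1..num_users G}"

text \<open>The physical graph is allowed to be directed here.\<close>

locale spectrum_access =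
  fixes G :: spectrum_network
  assumes vacant_subset: "n \<in> users G \<Longrightarrow> vacant G n \<subseteq> {1..num_channels G}"
    and vacant_nonempty: "n \<in> users G \<Longrightarrow> vacant G n \<noteq> {}"
    and power_pos: "n \<in> users G \<Longrightarrow> tx_power G n > 0"
    and distance_pos:
      "\<lbrakk>m \<in> users G; n \<in> users G; m \<noteq> n\<rbrakk> \<Longrightarrow> distance G m n > 0"
    and distance_sym:
      "\<lbrakk>m \<in> users G; n \<in> users G; m \<noteq> n\<rbrakk> \<Longrightarrow> distance G m n = distance G n m"
    and path_loss_pos: "path_loss G > 0"
    and phys_irrefl: "n \<in> users G \<Longrightarrow> \<not> phys_edge G n n"
    and soc_irrefl: "n \<in> users G \<Longrightarrow> \<not> soc_edge G n n"
    and soc_sym: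
      "\<lbrakk>n \<in> users G; m \<in> users G; soc_edge G n m\<rbrakk> \<Longrightarrow> soc_edge G m n"
    and tie_strength_range:
      "\<lbrakk>n \<in> users G; m \<in> users G; soc_edge G n m\<rbrakk> \<Longrightarrow> tie_strength G n m \<in> {0..1}"

definition phys_nbrs :: "spectrum_network \<Rightarrow> nat \<Rightarrow> nat set" where
  "phys_nbrs G n = {m \<in> users G. phys_edge G n m}"

definition soc_nbrs :: "spectrum_network \<Rightarrow> nat \<Rightarrow> nat set" where
  "soc_nbrs G n = {m \<in> users G. soc_edge G n m}"

definition phys_soc_nbrs :: "spectrum_network \<Rightarrow> nat \<Rightarrow> nat set" where
  "phys_soc_nbrs G n = soc_nbrs G n \<inter> phys_nbrs G n"

definition utility :: "spectrum_network \<Rightarrow> nat \<Rightarrow> (nat \<Rightarrow> nat) \<Rightarrow> real" where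
  "utility G n a =
     - (\<Sum>m\<in>phys_nbrs G n. tx_power G m * distance G m n powr (- path_loss G) * of_bool (a n = a m))
     - noise G n (a n)"

definition group_utility :: "spectrum_network \<Rightarrow> nat \<Rightarrow> (nat \<Rightarrow> nat) \<Rightarrow> real" where
  "group_utility G n a =
     utility G n a + (\<Sum>m\<in>soc_nbrs G n. tie_strength G n m * utility G m a)"

definition sgum_potential :: "spectrum_network \<Rightarrow> (nat \<Rightarrow> nat) \<Rightarrow> real" where
  "sgum_potential G a =
     - (1/2) * (\<Sum>n\<in>users G. \<Sum>m\<in>phys_nbrs G n.
         tx_power G m * distance G m n powr (- path_loss G) * of_bool (a n = a m))
     - (\<Sum>n\<in>users G. noise G n (a n))
     - (1/2) * (\<Sum>n\<in>users G. \<Sum>m\<in>phys_soc_nbrs G n.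
         tie_strength G n m * tx_power G m * distance G m n powr (- path_loss G)
           * of_bool (a n = a m))"

definition socially_aware_NE :: "spectrum_network \<Rightarrow> (nat \<Rightarrow> nat) \<Rightarrow> bool" where
  "socially_aware_NE G a \<longleftrightarrow> nash_equilibrium (users G) (vacant G) (group_utility G) a"

end

theory Submission
  imports Defs
begin

text \<open>The payoff \<open>S\<^sub>n\<close> and the potential are, up to the noise terms, built from the pairwise
  interferences \<open>P\<^sub>m d\<^sub>m\<^sub>n powr (- \<alpha>)\<close>. Equal powers and undirected links make these symmetric in the
  two users. When only user \<open>n\<close> deviates, only pairs containing \<open>n\<close> change, and each of them occurs
  twice in the symmetric double sums of the potential; this cancels the factors \<open>1/2\<close>. On the side
  of \<open>S\<^sub>n\<close>, each term \<open>w\<^sub>n\<^sub>m U\<^sub>m\<close> changes only through the one pair \<open>{m, n}\<close>, and only if \<open>m\<close> is also a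
  physical neighbour. An equilibrium is obtained by maximising the potential over the finitely many
  profiles.\<close>

lemma exact_potential_imp_nash_equilibrium:
  assumes "finite I" and "\<And>i. i \<in> I \<Longrightarrow> finite (A i)" and "\<And>i. i \<in> I \<Longrightarrow> A i \<noteq> {}"
    and pot: "exact_potential I A u \<Phi>"
  shows "\<exists>a. nash_equilibrium I A u a"
proof -
  have "finite (Pi\<^sub>E I A)" and "Pi\<^sub>E I A \<noteq> {}"
    using assms by (auto intro: finite_PiE simp: PiE_eq_empty_iff)
  then obtain a where a: "a \<in> Pi\<^sub>E I A" and max: "\<And>b. b \<in> Pi\<^sub>E I A \<Longrightarrow> \<Phi> b \<le> \<Phi> a"
    using Max_in[of "\<Phi> ` Pi\<^sub>E I A"] Max_ge[of "\<Phi> ` Pi\<^sub>E I A"]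
    by (metis (no_types, lifting) finite_imageI image_iff image_is_empty)
  have "u n (a(n := x)) \<le> u n a" if n: "n \<in> I" and x: "x \<in> A n" for n x
  proof -
    \<comment> \<open>\<open>exact_potential\<close> quantifies over choices of the opponents that
      are extensional on \<open>I - {n}\<close>, so the entry of \<open>a\<close> at
      \<open>n\<close> is erased first. Updating \<open>?b\<close> at \<open>n\<close> with
      \<open>a n\<close> gives back \<open>a\<close>.\<close>
    let ?b = "a(n := undefined)"
    have "?b \<in> Pi\<^sub>E (I - {n}) A"
      using a by (auto simp: PiE_iff extensional_def)
    moreover have "a n \<in> A n"
      using a n by auto
    ultimately have "u n (?b(n := x)) - u n (?b(n := a n)) = \<Phi> (?b(n := x)) - \<Phi> (?b(n := a n))"
      using pot n x unfolding exact_potential_def by blast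
    moreover have "a(n := x) \<in> Pi\<^sub>E I A"
      using a n x by (auto simp: PiE_iff extensional_def)
    ultimately show ?thesis
      using max[of "a(n := x)"] by simp
  qed
  with a show ?thesis
    unfolding nash_equilibrium_def by blast
qed

text \<open>Viewed as a matrix, \<open>h\<close> lives on row \<open>n\<close> and column
  \<open>n\<close>. By symmetry both have the same sum, and the entry where they meet is 0, so
  nothing is counted twice. This is where the factors 1/2 of the potential are absorbed.\<close>

lemma sum_sum_symmetric_cross:
  fixes h :: "'a \<Rightarrow> 'a \<Rightarrow> real"
  assumes "finite U" and n: "n \<in> U"
    and sym: "\<And>i j. \<lbrakk>i \<in> U; j \<in> U\<rbrakk> \<Longrightarrow> h i j = h j i"
    and off: "\<And>i j. \<lbrakk>i \<noteq> n; j \<noteq> n\<rbrakk> \<Longrightarrow> h i j = 0"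
    and diag: "h n n = 0"
  shows "(\<Sum>i\<in>U. \<Sum>j\<in>U. h i j) = 2 * (\<Sum>j\<in>U. h n j)"
proof -
  have "(\<Sum>j\<in>U. h i j) = h n i" if i: "i \<in> U - {n}" for i
  proof -
    have "(\<Sum>j\<in>U. h i j) = h i n + (\<Sum>j\<in>U - {n}. h i j)"
      using assms(1) n by (rule sum.remove)
    also have "\<dots> = h n i"
      using i n sym off by simp
    finally show ?thesis .
  qed
  then have "(\<Sum>i\<in>U. \<Sum>j\<in>U. h i j) = (\<Sum>j\<in>U. h n j) + (\<Sum>i\<in>U - {n}. h n i)"
    using sum.remove[OF assms(1) n, of "\<lambda>i. \<Sum>j\<in>U. h i j"] by simp
  also have "(\<Sum>i\<in>U - {n}. h n i) = (\<Sum>j\<in>U. h n j)"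
    using sum.remove[OF assms(1) n, of "h n"] diag by simp
  finally show ?thesis by simp
qed

text \<open>Extending by 0 off the edges, here and in \<open>tie\<close>, lets every neighbourhood
  sum run over all users. The double sums then have a square index set, on which symmetry in the two
  users can be exploited.\<close>

definition interference :: "spectrum_network \<Rightarrow> nat \<Rightarrow> nat \<Rightarrow> real" where
  "interference G n m =
     (if phys_edge G n m then tx_power G m * distance G m n powr (- path_loss G) else 0)"

definition tie :: "spectrum_network \<Rightarrow> nat \<Rightarrow> nat \<Rightarrow> real" where
  "tie G n m = (if soc_edge G n m then tie_strength G n m else 0)"

lemma finite_users: "finite (users G)"
  by (simp add: users_def)

lemma utility_eq:
  "utility G n a = - (\<Sum>m\<in>users G. interference G n m * of_bool (a n = a m)) - noise G n (a n)"
  unfolding utility_def phys_nbrs_def interference_def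
  by (simp add: sum.inter_filter[OF finite_users] if_distrib[of "\<lambda>x. x * _"] cong: if_cong)

lemma group_utility_eq:
  "group_utility G n a = utility G n a + (\<Sum>m\<in>users G. tie G n m * utility G m a)"
  unfolding group_utility_def soc_nbrs_def tie_def
  by (simp add: sum.inter_filter[OF finite_users] if_distrib[of "\<lambda>x. x * _"] cong: if_cong)

text \<open>The product of \<open>tie\<close> and \<open>interference\<close> vanishes unless both
  edges are present, so it encodes the intersection in \<open>phys_soc_nbrs\<close>.\<close>

lemma sgum_potential_eq:
  "sgum_potential G a =
     - (1/2) * (\<Sum>n\<in>users G. \<Sum>m\<in>users G. interference G n m * of_bool (a n = a m))
     - (\<Sum>n\<in>users G. noise G n (a n))
     - (1/2) * (\<Sum>n\<in>users G. \<Sum>m\<in>users G. tie G n m * interference G n m * of_bool (a n = a m))"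
proof -
  have phys: "(\<Sum>m\<in>phys_nbrs G n.
        tx_power G m * distance G m n powr (- path_loss G) * of_bool (a n = a m))
      = (\<Sum>m\<in>users G. interference G n m * of_bool (a n = a m))" for n
    unfolding phys_nbrs_def interference_def sum.inter_filter[OF finite_users]
    by (rule sum.cong) auto
  have nbrs: "phys_soc_nbrs G n = {m \<in> users G. soc_edge G n m \<and> phys_edge G n m}" for n
    by (auto simp: phys_soc_nbrs_def soc_nbrs_def phys_nbrs_def)
  have soc: "(\<Sum>m\<in>phys_soc_nbrs G n.
        tie_strength G n m * tx_power G m * distance G m n powr (- path_loss G)
          * of_bool (a n = a m))
      = (\<Sum>m\<in>users G. tie G n m * interference G n m * of_bool (a n = a m))" for n
    unfolding nbrs interference_def tie_def sum.inter_filter[OF finite_users]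
    by (rule sum.cong) auto
  show ?thesis
    unfolding sgum_potential_def phys soc ..
qed

locale symmetric_spectrum_access = spectrum_access +
  assumes equal_power: "\<lbrakk>n \<in> users G; m \<in> users G\<rbrakk> \<Longrightarrow> tx_power G n = tx_power G m"
    and phys_sym: "\<lbrakk>n \<in> users G; m \<in> users G\<rbrakk> \<Longrightarrow> phys_edge G n m \<longleftrightarrow> phys_edge G m n"
    and strength_sym:
      "\<lbrakk>n \<in> users G; m \<in> users G; soc_edge G n m\<rbrakk> \<Longrightarrow> tie_strength G n m = tie_strength G m n"
begin

lemma interference_sym:
  assumes "n \<in> users G" and "m \<in> users G"
  shows "interference G n m = interference G m n"
\<comment> \<open>Distances are known to be symmetric only between distinct users.\<close>
proof (cases "n = m")
  case False
  then show ?thesis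
    using assms equal_power[of n m] phys_sym[of n m] distance_sym[of n m]
    by (simp add: interference_def)
qed simp

lemma tie_sym: "\<lbrakk>n \<in> users G; m \<in> users G\<rbrakk> \<Longrightarrow> tie G n m = tie G m n"
  using soc_sym[of n m] soc_sym[of m n] strength_sym[of n m] by (auto simp: tie_def)

lemma interference_self: "n \<in> users G \<Longrightarrow> interference G n n = 0"
  by (simp add: interference_def phys_irrefl)

lemma tie_self: "n \<in> users G \<Longrightarrow> tie G n n = 0"
  by (simp add: tie_def soc_irrefl)

lemma exact_potential_sgum:
  "exact_potential (users G) (vacant G) (group_utility G) (sgum_potential G)"
  unfolding exact_potential_def
proof (intro ballI)
  fix n x x' and b :: "nat \<Rightarrow> nat"
  assume n: "n \<in> users G"
  define a where "a = b(n := x)"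
  define a' where "a' = b(n := x')"
  \<comment> \<open>The change of the collision indicator of a pair. It vanishes on pairs that avoid
    the deviating user \<open>n\<close>, which is the support condition of
    \<open>sum_sum_symmetric_cross\<close>.\<close>
  define \<delta> :: "nat \<Rightarrow> nat \<Rightarrow> real"
    where "\<delta> i j = of_bool (a' i = a' j) - of_bool (a i = a j)" for i j
  let ?U = "users G" and ?g = "interference G" and ?t = "tie G"
  let ?\<nu> = "noise G n (a' n) - noise G n (a n)"
  have \<delta>_sym: "\<delta> i j = \<delta> j i" for i j
    by (auto simp: \<delta>_def)
  have \<delta>_off: "\<delta> i j = 0" if "i \<noteq> n" "j \<noteq> n" for i j
    using that by (simp add: \<delta>_def a_def a'_def)
  have utility_diff: "utility G m a' - utility G m a
      = - (\<Sum>j\<in>?U. ?g m j * \<delta> m j) - (noise G m (a' m) - noise G m (a m))" for m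
    by (simp add: utility_eq \<delta>_def right_diff_distrib sum_subtractf)
  have utility_diff_other: "utility G m a' - utility G m a = - (?g n m * \<delta> n m)"
    if m: "m \<in> ?U" "m \<noteq> n" for m
  proof -
    \<comment> \<open>For a user other than \<open>n\<close>, the only collision that can change is
      the one with \<open>n\<close>.\<close>
    have "(\<Sum>j\<in>?U. ?g m j * \<delta> m j) = ?g m n * \<delta> m n"
      using m \<delta>_off by (simp add: sum.remove[OF finite_users n])
    moreover have "a' m = a m"
      using m by (simp add: a_def a'_def)
    ultimately show ?thesis
      using interference_sym[OF m(1) n] \<delta>_sym[of m n] by (simp add: utility_diff)
  qed
  have "group_utility G n a' - group_utility G n a
      = (utility G n a' - utility G n a)
        + (\<Sum>m\<in>?U. ?t n m * (utility G m a' - utility G m a))"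
    by (simp add: group_utility_eq right_diff_distrib sum_subtractf)
  also have "(\<Sum>m\<in>?U. ?t n m * (utility G m a' - utility G m a))
      = (\<Sum>m\<in>?U. - (?t n m * ?g n m * \<delta> n m))"
  \<comment> \<open>The summand \<open>m = n\<close>, to which \<open>utility_diff_other\<close>
    does not apply, is 0 on both sides because no user has a tie to itself.\<close>
  proof (rule sum.cong)
    fix m assume "m \<in> ?U"
    then show "?t n m * (utility G m a' - utility G m a) = - (?t n m * ?g n m * \<delta> n m)"
      using utility_diff_other[of m] tie_self[OF n] by (cases "m = n") auto
  qed simp
  finally have payoff: "group_utility G n a' - group_utility G n a
      = - (\<Sum>j\<in>?U. ?g n j * \<delta> n j) - ?\<nu> - (\<Sum>j\<in>?U. ?t n j * ?g n j * \<delta> n j)"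
    by (simp add: utility_diff sum_negf)

  have phys: "(\<Sum>i\<in>?U. \<Sum>j\<in>?U. ?g i j * \<delta> i j) = 2 * (\<Sum>j\<in>?U. ?g n j * \<delta> n j)"
    using \<delta>_sym \<delta>_off interference_sym interference_self[OF n]
    by (intro sum_sum_symmetric_cross[OF finite_users n]) auto
  have soc: "(\<Sum>i\<in>?U. \<Sum>j\<in>?U. ?t i j * ?g i j * \<delta> i j) = 2 * (\<Sum>j\<in>?U. ?t n j * ?g n j * \<delta> n j)"
    using \<delta>_sym \<delta>_off interference_sym tie_sym tie_self[OF n]
    by (intro sum_sum_symmetric_cross[OF finite_users n]) auto
  \<comment> \<open>Noise depends only on a user's own channel, so only the term of \<open>n\<close>
    changes.\<close>
  have "(\<Sum>i\<in>?U. noise G i (a' i)) - (\<Sum>i\<in>?U. noise G i (a i)) = ?\<nu>"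
    by (simp add: sum.remove[OF finite_users n] a_def a'_def)
  moreover have "sgum_potential G a' - sgum_potential G a
      = - (1/2) * (\<Sum>i\<in>?U. \<Sum>j\<in>?U. ?g i j * \<delta> i j)
        - ((\<Sum>i\<in>?U. noise G i (a' i)) - (\<Sum>i\<in>?U. noise G i (a i)))
        - (1/2) * (\<Sum>i\<in>?U. \<Sum>j\<in>?U. ?t i j * ?g i j * \<delta> i j)"
    by (simp add: sgum_potential_eq \<delta>_def right_diff_distrib sum_subtractf)
  ultimately have "sgum_potential G a' - sgum_potential G a
      = group_utility G n a' - group_utility G n a"
    by (simp add: payoff phys soc)
  then show "group_utility G n (b(n := x')) - group_utility G n (b(n := x))
      = sgum_potential G (b(n := x')) - sgum_potential G (b(n := x))"
    by (simp add: a_def a'_def)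
qed

lemma socially_aware_NE_exists: "\<exists>a. socially_aware_NE G a"
  unfolding socially_aware_NE_def
  by (rule exact_potential_imp_nash_equilibrium[OF finite_users _ _ exact_potential_sgum])
    \<comment> \<open>Strategy sets are finite as subsets of the finite set of channels.\<close>
    (use vacant_subset vacant_nonempty in \<open>auto intro: finite_subset\<close>)

end

theorem theorem1:
  fixes G :: spectrum_network
  assumes "spectrum_access G"
    and "\<forall>n\<in>users G. \<forall>m\<in>users G. tx_power G n = tx_power G m"
    and "\<forall>n\<in>users G. \<forall>m\<in>users G. phys_edge G n m \<longleftrightarrow> phys_edge G m n"
    and "\<forall>n\<in>users G. \<forall>m\<in>users G. soc_edge G n m \<longrightarrow> tie_strength G n m = tie_strength G m n"
  shows "exact_potential (users G) (vacant G) (group_utility G) (sgum_potential G)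
    \<and> (\<exists>a. socially_aware_NE G a)"
proof -
  interpret spectrum_access G by fact
  interpret symmetric_spectrum_access G
    using assms(2-4) by unfold_locales blast+
  show ?thesis
    using exact_potential_sgum socially_aware_NE_exists by blast
qed

end
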